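(* Let $T$ be a non-empty finite set of positive integers with largest element $c$. Let $m$ be the smallest nonnegative integer such that for all integers $i\ge m$, \[ \tfrac12 i^2+\left(\tfrac32-c\right)i+\left(1+\tfrac12 c-\tfrac32 c^2\right) > 0, \] and let $d$ be the maximum of $2c+m-1$ and $\max_{-2c+2\le i\le c+m}\{f_T(i+c)-f_T(i)-f_T(i+1)+i+1\}$. Suppose $k$ is an integer with $k\ge\max\{2d-4c+2,\ 4c+d+1\}$ and \[ k > \max_{-2c+2\le i\le c+d+2}\{f_T(i-1+c)-f_T(i-1)-f_T(i)+i+2c-1\}. \] Then the $S$-LID sequence $(a_n)_{n\ge1}$ for $S=[k]\setminus(k-T)$ satisfies $a_{n+1}=a_n+a_{n-k}$ for all integers $n>k+c$.
   Context: $[k]=\{1,\dots,k\}$ and $k-T=\{k-t:t\in T\}$. For a set $S$ of positive integers, the $S$-legal index difference ($S$-LID) sequence $(a_n)_{n\ge 1}$ is defined recursively: for each positive integer $n$, $a_n$ is the smallest positive integer that cannot be written as $\sum_{\ell\in L} a_\ell$ for some set $L \subseteq \{1,\dots,n-1\}$ such that $|i-j|\notin S$ for all $i,j\in L$ (the empty sum is $0$). For each positive integer $k$ write $(a^{(k)}_n)$ for the $([k]\setminus(k-T))$-LID sequence. For each integer $i$, $f_T(i)$ denotes the integer such that $a^{(k)}_{k+i}=k+f_T(i)$ for every integer $k$ with $k>-i$ and $k\ge i+2c-1$ (this value is independent of such $k$; e.g. $f_T(i)=i$ for $i\le -c+1$). *)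

theory Defs
  imports Complex_Main
begin

definition legal :: "int set \<Rightarrow> int set \<Rightarrow> bool" where
  "legal S L \<longleftrightarrow> (\<forall>i\<in>L. \<forall>j\<in>L. \<bar>i - j\<bar> \<notin> S)"

text \<open>Only the values at indices \<open>n \<ge> 1\<close> are meaningful; for \<open>n \<le> 0\<close> the equation yields
  the value 1, which no other term refers to.\<close>

function lid :: "int set \<Rightarrow> int \<Rightarrow> int" where
  "lid S n = (LEAST x. x > 0 \<and>
     \<not> (\<exists>L\<in>{L. L \<subseteq> {1..n - 1} \<and> legal S L}. x = (\<Sum>l\<in>L. lid S l)))"
  by pat_completeness auto
termination
  by (relation "measure (\<lambda>(S, n). nat n)") auto

declare lid.simps [simp del]

definition lid_set :: "int set \<Rightarrow> int \<Rightarrow> int set" where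
  "lid_set T k = {1..k} - (\<lambda>t. k - t) ` T"

definition f_T :: "int set \<Rightarrow> int \<Rightarrow> int" where
  "f_T T i = (THE v. \<forall>k. k > - i \<and> k \<ge> i + 2 * Max T - 1 \<longrightarrow>
     lid (lid_set T k) (k + i) = k + v)"

end

theory Submission
  imports Defs
begin

text \<open>
  Write \<open>a\<close> for the sequence. Adding \<open>n\<close> to the legal sets inside \<open>{1..n - k - 1}\<close> always gives
  \<open>a (n + 1) \<ge> a n + a (n - k)\<close>, and equality can only fail if some legal set avoiding \<open>n\<close> sums to
  \<open>a n + a (n - k)\<close>. Distinct members of a legal set are at least \<open>k - c\<close> apart, so a legal sum
  inside \<open>{1..n}\<close> is at most \<open>B n = a n + a (n - (k - c)) + a (n - 2 * (k - c)) + \<dots>\<close>; hence it suffices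
  that \<open>slack q = a (q - 1) + a q - B (q - 1 + c)\<close> is positive for \<open>q = n - k\<close>. For
  \<open>q \<le> k - 2 * c + 1\<close> the slack is \<open>q - c\<close>, and up to \<open>q = k + c + 1\<close> the choice of \<open>d\<close> makes it at
  least \<open>2 * c + 2\<close>. Past that point it does not decrease: the recurrence turns its increment at \<open>p\<close>
  into \<open>slack (p - k)\<close> minus an error of at most \<open>2 * c + 2\<close> coming from the indices up to \<open>k + c\<close>,
  where the recurrence is not available.
\<close>

lemma bounded_int_Least:
  fixes P :: "int \<Rightarrow> bool"
  assumes "P x" and bound: "\<And>y. P y \<Longrightarrow> b \<le> y"
  shows bounded_int_LeastI: "P (LEAST y. P y)"
    and bounded_int_Least_le: "P z \<Longrightarrow> (LEAST y. P y) \<le> z"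
proof -
  obtain z0 where "P z0" and least: "\<And>y. P y \<Longrightarrow> z0 \<le> y"
  proof (rule wfE_min[OF wf_int_ge_less_than[of b], of x "Collect P"])
    show "x \<in> Collect P" using \<open>P x\<close> by simp
  next
    fix z assume "z \<in> Collect P"
      and "\<And>y. (y, z) \<in> int_ge_less_than b \<Longrightarrow> y \<notin> Collect P"
    then show thesis
      using that[of z] bound by (force simp: int_ge_less_than_def not_less)
  qed
  then have "(LEAST y. P y) = z0" by (rule Least_equality)
  then show "P (LEAST y. P y)" and "P z \<Longrightarrow> (LEAST y. P y) \<le> z"
    using \<open>P z0\<close> least by auto
qed

lemma legal_subset: "legal S L \<Longrightarrow> M \<subseteq> L \<Longrightarrow> legal S M"
  unfolding legal_def by blast

lemma legal_empty [simp]: "legal S {}"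
  and legal_singleton [simp]: "legal S {i} \<longleftrightarrow> 0 \<notin> S"
  by (simp_all add: legal_def)

lemma legal_insert:
  "legal S (insert i L) \<longleftrightarrow> 0 \<notin> S \<and> (\<forall>j\<in>L. \<bar>i - j\<bar> \<notin> S) \<and> legal S L"
  unfolding legal_def by (auto simp: abs_minus_commute)

definition representable :: "int set \<Rightarrow> int \<Rightarrow> int \<Rightarrow> bool" where
  "representable S n x \<longleftrightarrow> (\<exists>L. L \<subseteq> {1..n} \<and> legal S L \<and> x = (\<Sum>l\<in>L. lid S l))"

lemma representableI:
  "L \<subseteq> {1..n} \<Longrightarrow> legal S L \<Longrightarrow> x = (\<Sum>l\<in>L. lid S l) \<Longrightarrow> representable S n x"
  unfolding representable_def by blast

lemma representableE:
  assumes "representable S n x"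
  obtains L where "L \<subseteq> {1..n}" "finite L" "legal S L" "x = (\<Sum>l\<in>L. lid S l)"
  using assms finite_subset[of _ "{1..n}"] unfolding representable_def by blast

lemma representable_0 [simp]: "representable S n 0"
  by (rule representableI[of "{}"]) simp_all

lemma representable_nonpos_iff: "n \<le> 0 \<Longrightarrow> representable S n x \<longleftrightarrow> x = 0"
  by (auto simp: representable_def)

lemma representable_mono: "representable S n x \<Longrightarrow> n \<le> n' \<Longrightarrow> representable S n' x"
  by (elim representableE, rule representableI) auto

lemma representable_lid: "0 \<notin> S \<Longrightarrow> 1 \<le> i \<Longrightarrow> i \<le> n \<Longrightarrow> representable S n (lid S i)"
  by (rule representableI[of "{i}"]) simp_all

lemma finite_representable: "finite {x. representable S n x}"
proof (rule finite_subset)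
  show "{x. representable S n x} \<subseteq> (\<lambda>L. \<Sum>l\<in>L. lid S l) ` Pow {1..n}"
    unfolding representable_def by blast
qed simp

lemma lid_eq_Least_not_representable: "lid S n = (LEAST x. x > 0 \<and> \<not> representable S (n - 1) x)"
  by (subst lid.simps) (simp add: representable_def Bex_def)

lemma lid_pos: "0 < lid S n"
  and lid_not_representable: "\<not> representable S (n - 1) (lid S n)"
  and lid_le: "0 < x \<Longrightarrow> \<not> representable S (n - 1) x \<Longrightarrow> lid S n \<le> x"
proof -
  define P where "P x \<longleftrightarrow> x > 0 \<and> \<not> representable S (n - 1) x" for x
  have nonneg: "P y \<Longrightarrow> 0 \<le> y" for y
    unfolding P_def by simp
  have "\<not> {0<..} \<subseteq> {x. representable S (n - 1) x}"
    using finite_representable[of S "n - 1"] infinite_Ioi[of "0::int"] finite_subset by blast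
  then obtain x0 where "P x0"
    unfolding P_def by auto
  from bounded_int_LeastI[of P, OF this nonneg] bounded_int_Least_le[of P, OF this nonneg]
  show "0 < lid S n" "\<not> representable S (n - 1) (lid S n)"
    "0 < x \<Longrightarrow> \<not> representable S (n - 1) x \<Longrightarrow> lid S n \<le> x"
    unfolding lid_eq_Least_not_representable by (simp_all add: P_def)
qed

lemma representable_below_lid: "0 \<le> x \<Longrightarrow> x < lid S n \<Longrightarrow> representable S (n - 1) x"
  using lid_le[of x S n] by (cases "x = 0") force+

lemma lid_strict_mono:
  assumes "0 \<notin> S" "1 \<le> n" "n < n'"
  shows "lid S n < lid S n'"
proof (rule ccontr)
  assume "\<not> lid S n < lid S n'"
  then consider (eq) "lid S n' = lid S n" | (less) "lid S n' < lid S n" by linarith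
  then have "representable S n (lid S n')"
  proof cases
    case eq
    then show ?thesis using representable_lid assms(1,2) by simp
  next
    case less
    then have "representable S (n - 1) (lid S n')"
      using lid_pos[of S n'] by (intro representable_below_lid) simp_all
    then show ?thesis by (rule representable_mono) simp
  qed
  then have "representable S (n' - 1) (lid S n')"
    by (rule representable_mono) (use assms(3) in simp)
  then show False using lid_not_representable by blast
qed

lemma lid_mono: "0 \<notin> S \<Longrightarrow> 1 \<le> n \<Longrightarrow> n \<le> n' \<Longrightarrow> lid S n \<le> lid S n'"
  using lid_strict_mono[of S n n'] by (cases "n = n'") auto

lemma representable_lid_add:
  assumes "0 \<notin> S" "S \<subseteq> {..k}" "0 \<le> k" "1 \<le> n" and "representable S (n - k - 1) x"
  shows "representable S n (lid S n + x)"
proof -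
  obtain L where legal_L: "L \<subseteq> {1..n - k - 1}" "finite L" "legal S L" "x = (\<Sum>l\<in>L. lid S l)"
    using assms(5) by (rule representableE)
  have far: "k < \<bar>n - l\<bar>" if "l \<in> L" for l
    using subsetD[OF legal_L(1) that] assms(3) by simp
  show ?thesis
  proof (rule representableI[of "insert n L"])
    show "insert n L \<subseteq> {1..n}" using legal_L(1) assms(3,4) by force
    show "legal S (insert n L)" using far legal_L(3) assms(1,2) by (force simp: legal_insert)
    show "lid S n + x = (\<Sum>l\<in>insert n L. lid S l)" using far[of n] legal_L(2,4) assms(3) by force
  qed
qed

lemma lid_superadditive:
  assumes "0 \<notin> S" "S \<subseteq> {..k}" "0 \<le> k" "1 \<le> n"
  shows "lid S n + lid S (n - k) \<le> lid S (n + 1)"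
proof (rule ccontr)
  assume "\<not> ?thesis"
  moreover have "lid S n < lid S (n + 1)"
    using assms by (intro lid_strict_mono) auto
  ultimately have "representable S (n - k - 1) (lid S (n + 1) - lid S n)"
    by (intro representable_below_lid) auto
  then have "representable S n (lid S (n + 1))"
    using representable_lid_add[OF assms] by fastforce
  then show False using lid_not_representable[of S "n + 1"] by simp
qed

lemma legal_sum_neq_lid_add:
  assumes "0 \<notin> S" "k \<in> S" "0 \<le> k" "k < n" and legal_L: "L \<subseteq> {1..n}" "legal S L" "n \<in> L"
  shows "(\<Sum>l\<in>L. lid S l) \<noteq> lid S n + lid S (n - k)"
proof
  assume "(\<Sum>l\<in>L. lid S l) = lid S n + lid S (n - k)"
  moreover have fin: "finite L" using legal_L(1) finite_subset by blast
  ultimately have rest: "lid S (n - k) = (\<Sum>l\<in>L - {n}. lid S l)"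
    using sum.remove[OF fin legal_L(3), of "lid S"] by simp
  have "L - {n} \<subseteq> {1..n - k - 1}"
  proof
    fix l assume l_rest: "l \<in> L - {n}"
    have "lid S l \<le> lid S (n - k)"
      unfolding rest using l_rest fin lid_pos[of S] by (intro member_le_sum) (auto intro: less_imp_le)
    then have "l \<le> n - k"
      using lid_strict_mono[of S "n - k" l] assms(1,4) by (cases "l \<le> n - k") auto
    moreover have "\<bar>n - l\<bar> \<notin> S" using legal_L(2,3) l_rest unfolding legal_def by blast
    then have "l \<noteq> n - k" using assms(2,3) by auto
    ultimately show "l \<in> {1..n - k - 1}" using l_rest legal_L(1) by auto
  qed
  then have "representable S (n - k - 1) (lid S (n - k))"
    using rest legal_L(2) by (intro representableI[of "L - {n}"]) (auto intro: legal_subset)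
  then show False using lid_not_representable by blast
qed

function stride_sum :: "(int \<Rightarrow> 'a::comm_monoid_add) \<Rightarrow> int \<Rightarrow> int \<Rightarrow> 'a" where
  "stride_sum f r n = (if n \<le> 0 \<or> r \<le> 0 then 0 else f n + stride_sum f r (n - r))"
  by pat_completeness auto
termination
  by (relation "measure (\<lambda>(f, r, n). nat n)") auto

declare stride_sum.simps [simp del]

lemma stride_sum_nonpos [simp]: "n \<le> 0 \<Longrightarrow> stride_sum f r n = 0"
  by (simp add: stride_sum.simps)

lemma stride_sum_pos: "0 < n \<Longrightarrow> 0 < r \<Longrightarrow> stride_sum f r n = f n + stride_sum f r (n - r)"
  by (subst stride_sum.simps) simp

lemma stride_sum_nonneg:
  fixes f :: "int \<Rightarrow> 'a::ordered_comm_monoid_add"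
  assumes "\<And>i. 1 \<le> i \<Longrightarrow> 0 \<le> f i"
  shows "0 \<le> stride_sum f r n"
  using assms
proof (induction f r n rule: stride_sum.induct)
  case (1 f r n)
  then show ?case by (subst stride_sum.simps) (auto intro!: add_nonneg_nonneg)
qed

lemma stride_sum_mono:
  fixes f :: "int \<Rightarrow> 'a::ordered_comm_monoid_add"
  assumes nonneg: "\<And>i. 1 \<le> i \<Longrightarrow> 0 \<le> f i" and "mono_on {1..} f" and "n \<le> n'"
  shows "stride_sum f r n \<le> stride_sum f r n'"
  using assms(3)
proof (induction "nat n" arbitrary: n n' rule: less_induct)
  case less
  show ?case
  proof (cases "n \<le> 0 \<or> r \<le> 0")
    case True
    then have "stride_sum f r n = 0" by (simp add: stride_sum.simps)
    then show ?thesis using stride_sum_nonneg[OF nonneg] by simp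
  next
    case False
    then have "f n \<le> f n'"
      using less.prems by (intro mono_onD[OF assms(2)]) auto
    moreover have "stride_sum f r (n - r) \<le> stride_sum f r (n' - r)"
      using False less.prems by (intro less.hyps) auto
    ultimately show ?thesis
      using False less.prems by (simp add: stride_sum_pos add_mono)
  qed
qed

locale gapped =
  fixes S :: "int set" and r :: int
  assumes zero_notin: "0 \<notin> S" and below_gap: "{1..<r} \<subseteq> S"
begin

abbreviation a where "a \<equiv> lid S"

lemma legal_gap:
  assumes "legal S L" "i \<in> L" "j \<in> L" "i < j"
  shows "r \<le> j - i"
proof -
  have "\<bar>j - i\<bar> \<notin> S" using assms unfolding legal_def by blast
  then have "j - i \<notin> S" using assms(4) by simp
  then have "j - i \<notin> {1..<r}" using below_gap by blast
  then show ?thesis using assms(4) by simp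
qed

lemma legal_split_Max:
  assumes "legal S L" "L \<subseteq> {1..n}" "L \<noteq> {}"
  obtains j where "j \<in> L" "j \<in> {1..n}" "L - {j} \<subseteq> {1..j - r}" "legal S (L - {j})"
    "(\<Sum>l\<in>L. a l) = a j + (\<Sum>l\<in>L - {j}. a l)"
proof
  have fin: "finite L" using assms(2) finite_subset by blast
  show Max: "Max L \<in> L" using fin assms(3) by (rule Max_in)
  then show "Max L \<in> {1..n}" using assms(2) by blast
  show "L - {Max L} \<subseteq> {1..Max L - r}"
  proof
    fix l assume l_rest: "l \<in> L - {Max L}"
    then have "l < Max L" using Max_ge[OF fin, of l] by auto
    then show "l \<in> {1..Max L - r}"
      using legal_gap[OF assms(1) _ Max, of l] l_rest assms(2) by auto
  qed
  show "legal S (L - {Max L})" using assms(1) by (rule legal_subset) blast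
  show "(\<Sum>l\<in>L. a l) = a (Max L) + (\<Sum>l\<in>L - {Max L}. a l)"
    using fin Max by (rule sum.remove)
qed

lemma representable_cases:
  assumes "representable S n x"
  obtains (zero) "x = 0" | (max) j where "j \<in> {1..n}" "representable S (j - r) (x - a j)"
proof -
  obtain L where legal_L: "L \<subseteq> {1..n}" "legal S L" "x = (\<Sum>l\<in>L. a l)"
    using assms by (rule representableE)
  show thesis
  proof (cases "L = {}")
    case True
    then show thesis using legal_L(3) that(1) by simp
  next
    case False
    with legal_L(2,1) obtain j where "j \<in> {1..n}" "L - {j} \<subseteq> {1..j - r}" "legal S (L - {j})"
      "(\<Sum>l\<in>L. a l) = a j + (\<Sum>l\<in>L - {j}. a l)"
      by (rule legal_split_Max)
    then show thesis using legal_L(3) that(2) representableI[of "L - {j}"] by simp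
  qed
qed

lemma lid_small: "1 \<le> n \<Longrightarrow> n \<le> r + 1 \<Longrightarrow> a n = n"
proof (induction "nat n" arbitrary: n rule: less_induct)
  case less
  have IH: "a j = j" if "1 \<le> j" "j < n" for j
    using less that by simp
  have "\<not> representable S (n - 1) n"
  proof
    assume "representable S (n - 1) n"
    then show False
    proof (cases rule: representable_cases)
      case zero
      then show False using less.prems by simp
    next
      case (max j)
      then show False using less.prems IH[of j] by (simp add: representable_nonpos_iff)
    qed
  qed
  then have "a n \<le> n" using lid_le less.prems by simp
  moreover have "n \<le> a n"
  proof (cases "n = 1")
    case True
    then show ?thesis using lid_pos[of S n] by simp
  next
    case False
    then show ?thesis
      using lid_strict_mono[OF zero_notin, of "n - 1" n] IH[of "n - 1"] less.prems by simp
  qed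
  ultimately show ?case by simp
qed

text \<open>Below \<open>2 * r\<close> a legal set has at most two members, and the smaller of two is at most \<open>r\<close>.\<close>

lemma representable_two_terms_cases:
  assumes "n \<le> 2 * r" "representable S n x"
  obtains (zero) "x = 0" | (one) j where "j \<in> {1..n}" "x = a j"
    | (two) j l where "j \<in> {1..n}" "l \<in> {1..j - r}" "j - l \<notin> S" "x = a j + l"
proof -
  obtain L where legal_L: "L \<subseteq> {1..n}" "legal S L" "x = (\<Sum>l\<in>L. a l)"
    using assms(2) by (rule representableE)
  show thesis
  proof (cases "L = {}")
    case True
    then show thesis using legal_L(3) that(1) by simp
  next
    case False
    with legal_L(2,1) obtain j where j_max: "j \<in> L" "j \<in> {1..n}" "L - {j} \<subseteq> {1..j - r}"
      "legal S (L - {j})" "(\<Sum>l\<in>L. a l) = a j + (\<Sum>l\<in>L - {j}. a l)"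
      by (rule legal_split_Max)
    show thesis
    proof (cases "L - {j} = {}")
      case True
      then have "x = a j" using legal_L(3) j_max(5) by (simp only: sum.empty add_0_right)
      then show thesis using j_max(2) that(2) by blast
    next
      case False
      with j_max(4,3) obtain l where l_max: "l \<in> L - {j}" "l \<in> {1..j - r}"
        "L - {j} - {l} \<subseteq> {1..l - r}" "(\<Sum>l\<in>L - {j}. a l) = a l + (\<Sum>l\<in>L - {j} - {l}. a l)"
        by (rule legal_split_Max)
      have "L - {j} - {l} = {}" using l_max(2,3) j_max(2) assms(1) by auto
      moreover have "a l = l" using l_max(2) j_max(2) assms(1) by (auto intro: lid_small)
      ultimately have "x = a j + l"
        using legal_L(3) j_max(5) l_max(4) by (simp only: sum.empty add_0_right)
      moreover have "\<bar>j - l\<bar> \<notin> S" using legal_L(2) j_max(1) l_max(1) unfolding legal_def by blast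
      then have "j - l \<notin> S" using l_max(2) j_max(2) assms(1) by simp
      ultimately show thesis using l_max(2) j_max(2) that(3) by blast
    qed
  qed
qed

lemma representable_iff_two_terms:
  assumes "n \<le> 2 * r"
  shows "representable S n x \<longleftrightarrow>
    x = 0 \<or> (\<exists>j\<in>{1..n}. x = a j \<or> (\<exists>l\<in>{1..j - r}. j - l \<notin> S \<and> x = a j + l))"
    (is "_ \<longleftrightarrow> ?two_terms")
proof
  assume "representable S n x"
  with assms show ?two_terms by (cases rule: representable_two_terms_cases) blast+
next
  assume ?two_terms
  then consider (zero) "x = 0" | (one) j where "j \<in> {1..n}" "x = a j"
    | (two) j l where "j \<in> {1..n}" "l \<in> {1..j - r}" "j - l \<notin> S" "x = a j + l"
    by blast
  then show "representable S n x"
  proof cases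
    case zero
    then show ?thesis by simp
  next
    case one
    then show ?thesis using representable_lid zero_notin by simp
  next
    case (two j l)
    then have "a l = l" "l < j" using assms by (auto intro: lid_small)
    then show ?thesis
      using two zero_notin by (intro representableI[of "{j, l}"]) (auto simp: legal_insert)
  qed
qed

lemma representable_le_stride_sum:
  assumes "0 < r"
  shows "representable S n x \<Longrightarrow> x \<le> stride_sum a r n"
proof (induction "nat n" arbitrary: n x rule: less_induct)
  case less
  have nonneg: "0 \<le> a i" for i using lid_pos[of S i] by simp
  from less.prems show ?case
  proof (cases rule: representable_cases)
    case zero
    then show ?thesis using stride_sum_nonneg[of a] nonneg by simp
  next
    case (max j)
    have "x - a j \<le> stride_sum a r (j - r)"
      using max assms by (intro less.hyps) auto
    then have "x \<le> stride_sum a r j" using max assms by (simp add: stride_sum_pos)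
    also have "\<dots> \<le> stride_sum a r n"
      using max nonneg lid_mono[OF zero_notin] by (intro stride_sum_mono mono_onI) auto
    finally show ?thesis .
  qed
qed

lemma lid_Suc_le_stride_sum:
  assumes "0 < r"
  shows "a (n + 1) \<le> stride_sum a r n + 1"
proof (rule lid_le)
  show "0 < stride_sum a r n + 1"
    using representable_le_stride_sum[OF assms, of n 0] by simp
  show "\<not> representable S (n + 1 - 1) (stride_sum a r n + 1)"
    using representable_le_stride_sum[OF assms, of n "stride_sum a r n + 1"] by auto
qed

end

lemma gapped_lid_set: "T \<subseteq> {1..c} \<Longrightarrow> 0 \<le> c \<Longrightarrow> gapped (lid_set T k) (k - c)"
  by unfold_locales (auto simp: lid_set_def)

lemma diff_notin_lid_set_iff:
  assumes "t < k"
  shows "k - t \<notin> lid_set T k \<longleftrightarrow> t < 0 \<or> t \<in> T"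
  using assms inj_image_mem_iff[of "\<lambda>t. k - t" t T] by (auto simp: lid_set_def inj_on_def)

definition lid_offset :: "int set \<Rightarrow> int \<Rightarrow> int \<Rightarrow> int" where
  "lid_offset T k i = lid (lid_set T k) (k + i) - k"

lemma lid_offset_small:
  assumes "T \<subseteq> {1..c}" "0 \<le> c" "- k < i" "i \<le> 1 - c"
  shows "lid_offset T k i = i"
proof -
  interpret gapped "lid_set T k" "k - c" using assms(1,2) by (rule gapped_lid_set)
  show ?thesis using assms lid_small[of "k + i"] by (simp add: lid_offset_def)
qed

text \<open>The right-hand side depends on \<open>k\<close> only through \<open>lid_offset T k\<close> on \<open>{- c<..<i}\<close>.\<close>

lemma representable_offset_iff:
  assumes T_subset: "T \<subseteq> {1..c}" and c_pos: "1 \<le> c"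
    and i_bounds: "1 - c < i" "i + 2 * c - 1 \<le> k" and y_gt: "- c < y"
  shows "representable (lid_set T k) (k + i - 1) (k + y) \<longleftrightarrow>
    (\<exists>j\<in>{- c<..<i}. y = lid_offset T k j \<or>
       (\<exists>l\<in>{1..j + c}. (l < j \<or> l - j \<in> T) \<and> y = lid_offset T k j + l))"
    (is "_ \<longleftrightarrow> (\<exists>j\<in>{- c<..<i}. ?term j)")
proof -
  interpret gapped "lid_set T k" "k - c" using T_subset c_pos by (intro gapped_lid_set) auto
  have shift: "k + y = a (k + j) + l \<longleftrightarrow> y = lid_offset T k j + l" for j l
    by (auto simp: lid_offset_def)
  have diff_notin: "k + j - l \<notin> lid_set T k \<longleftrightarrow> l < j \<or> l - j \<in> T" if "l \<le> j + c" for j l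
    using diff_notin_lid_set_iff[of "l - j" k T] that i_bounds c_pos by (simp add: algebra_simps)
  have two_terms: "(\<exists>l\<in>{1..j + c}. k + j - l \<notin> lid_set T k \<and> k + y = a (k + j) + l) \<longleftrightarrow>
      (\<exists>l\<in>{1..j + c}. (l < j \<or> l - j \<in> T) \<and> y = lid_offset T k j + l)" for j
    by (intro bex_cong refl) (simp add: diff_notin shift)
  have offset_minus_gap: "k + j - (k - c) = j + c" for j by simp
  have "k + y \<noteq> 0" using i_bounds c_pos y_gt by simp
  then have "representable (lid_set T k) (k + i - 1) (k + y) \<longleftrightarrow>
    (\<exists>m\<in>{1..k + i - 1}. k + y = a m \<or>
       (\<exists>l\<in>{1..m - (k - c)}. m - l \<notin> lid_set T k \<and> k + y = a m + l))"
    using representable_iff_two_terms[of "k + i - 1" "k + y"] i_bounds by simp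
  also have "{1..k + i - 1} = (+) k ` {1 - k..<i}" by auto
  also have "(\<exists>m\<in>(+) k ` {1 - k..<i}. k + y = a m \<or>
       (\<exists>l\<in>{1..m - (k - c)}. m - l \<notin> lid_set T k \<and> k + y = a m + l)) \<longleftrightarrow>
    (\<exists>j\<in>{1 - k..<i}. ?term j)"
    unfolding bex_simps(7) offset_minus_gap two_terms shift[of _ 0, simplified] by (rule refl)
  also have "\<dots> \<longleftrightarrow> (\<exists>j\<in>{- c<..<i}. ?term j)"
  proof -
    have "\<not> ?term j" if "1 - k \<le> j" "j \<le> - c" for j
      using lid_offset_small[OF T_subset, of k j] that c_pos y_gt by simp
    then show ?thesis using i_bounds c_pos by fastforce
  qed
  finally show ?thesis .
qed

lemma lid_offset_le_cong:
  assumes T_subset: "T \<subseteq> {1..c}" and c_pos: "1 \<le> c" and i_gt: "1 - c < i"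
    and k_ge: "i + 2 * c - 1 \<le> k" "i + 2 * c - 1 \<le> k'"
    and same: "\<And>j. - c < j \<Longrightarrow> j < i \<Longrightarrow> lid_offset T k' j = lid_offset T k j"
  shows "lid_offset T k' i \<le> lid_offset T k i"
proof -
  interpret gapped "lid_set T k" "k - c" using T_subset c_pos by (intro gapped_lid_set) auto
  define y where "y = lid_offset T k i"
  have "a (k - c + 1) < a (k + i)"
    using zero_notin i_gt c_pos k_ge by (intro lid_strict_mono) auto
  then have y_gt: "- c < y"
    using lid_small[of "k - c + 1"] i_gt c_pos k_ge by (simp add: y_def lid_offset_def)
  have "\<not> representable (lid_set T k) (k + i - 1) (k + y)"
    using lid_not_representable[of "lid_set T k" "k + i"] by (simp add: y_def lid_offset_def)
  then have "\<not> representable (lid_set T k') (k' + i - 1) (k' + y)"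
    unfolding representable_offset_iff[OF T_subset c_pos i_gt k_ge(1) y_gt]
      representable_offset_iff[OF T_subset c_pos i_gt k_ge(2) y_gt]
    using same by simp
  then have "lid (lid_set T k') (k' + i) \<le> k' + y"
    using y_gt i_gt c_pos k_ge by (intro lid_le) auto
  then show ?thesis by (simp add: y_def lid_offset_def)
qed

lemma lid_offset_eq:
  assumes T_subset: "T \<subseteq> {1..c}" and c_pos: "1 \<le> c"
  shows "- i < k \<Longrightarrow> i + 2 * c - 1 \<le> k \<Longrightarrow> - i < k' \<Longrightarrow> i + 2 * c - 1 \<le> k' \<Longrightarrow>
    lid_offset T k i = lid_offset T k' i"
proof (induction "nat (i + c)" arbitrary: i rule: less_induct)
  case less
  show ?case
  proof (cases "1 - c < i")
    case False
    then show ?thesis using less.prems c_pos lid_offset_small[OF T_subset] by simp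
  next
    case True
    have same: "lid_offset T k j = lid_offset T k' j" if "- c < j" "j < i" for j
      using that less.prems c_pos True by (intro less.hyps) auto
    show ?thesis
      using same less.prems
      by (intro antisym lid_offset_le_cong[OF T_subset c_pos True]) simp_all
  qed
qed

lemma f_T_eq_lid_offset:
  assumes T_bounds: "T \<subseteq> {1..Max T}" "1 \<le> Max T" and k_large: "- i < k" "i + 2 * Max T - 1 \<le> k"
  shows "f_T T i = lid_offset T k i"
  unfolding f_T_def
proof (rule the_equality)
  show "\<forall>k'. k' > - i \<and> k' \<ge> i + 2 * Max T - 1 \<longrightarrow>
      lid (lid_set T k') (k' + i) = k' + lid_offset T k i"
  proof (intro allI impI)
    fix k' assume "k' > - i \<and> k' \<ge> i + 2 * Max T - 1"
    then have "lid_offset T k i = lid_offset T k' i"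
      using k_large by (intro lid_offset_eq[OF T_bounds]) auto
    then show "lid (lid_set T k') (k' + i) = k' + lid_offset T k i"
      by (simp add: lid_offset_def)
  qed
next
  fix v
  assume "\<forall>k. k > - i \<and> k \<ge> i + 2 * Max T - 1 \<longrightarrow> lid (lid_set T k) (k + i) = k + v"
  then show "v = lid_offset T k i" using k_large by (simp add: lid_offset_def)
qed

locale lid_recurrence = gapped S "k - c" for S :: "int set" and k c :: int +
  assumes S_le: "S \<subseteq> {..k}" and k_in: "k \<in> S" and c_pos: "1 \<le> c" and k_ge: "6 * c + 1 \<le> k"
begin

abbreviation B where "B \<equiv> stride_sum a (k - c)"

definition slack where "slack q = a (q - 1) + a q - B (q - 1 + c)"

lemma a_superadditive: "1 \<le> n \<Longrightarrow> a n + a (n - k) \<le> a (n + 1)"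
  using zero_notin S_le k_ge c_pos by (intro lid_superadditive) auto

lemma B_pos: "0 < n \<Longrightarrow> B n = a n + B (n - (k - c))"
  using k_ge c_pos by (intro stride_sum_pos) auto

lemma B_nonneg: "0 \<le> B n"
  by (rule stride_sum_nonneg) (simp add: lid_pos less_imp_le)

lemma B_small: "0 \<le> n \<Longrightarrow> n \<le> k - c \<Longrightarrow> B n = n"
  using B_pos[of n] lid_small[of n] by (cases "n = 0") auto

lemma legal_sum_le: "L \<subseteq> {1..n} \<Longrightarrow> legal S L \<Longrightarrow> (\<Sum>l\<in>L. a l) \<le> B n"
  using k_ge c_pos by (intro representable_le_stride_sum representableI) auto

lemma legal_sum_lt_of_slack:
  assumes n_gt: "k + c < n" and slack_pos: "1 \<le> slack (n - k)"
    and legal_L: "L \<subseteq> {1..n}" "legal S L" "n \<notin> L"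
  shows "(\<Sum>l\<in>L. a l) < a n + a (n - k)"
proof -
  have "l \<in> {1..n - 1}" if "l \<in> L" for l
    using subsetD[OF legal_L(1) that] that legal_L(3) by (cases "l = n") auto
  then have "(\<Sum>l\<in>L. a l) \<le> B (n - 1)" using legal_L(2) by (intro legal_sum_le) auto
  also have "\<dots> = a (n - 1) + B (n - k - 1 + c)"
    using B_pos[of "n - 1"] n_gt c_pos k_ge by (simp add: algebra_simps)
  also have "\<dots> < a (n - 1) + a (n - 1 - k) + a (n - k)"
    using slack_pos unfolding slack_def by (simp add: algebra_simps)
  also have "\<dots> \<le> a n + a (n - k)"
    using a_superadditive[of "n - 1"] n_gt c_pos k_ge by simp
  finally show ?thesis .
qed

lemma recurrence_of_slack:
  assumes n_gt: "k + c < n" and slack_pos: "1 \<le> slack (n - k)"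
  shows "a (n + 1) = a n + a (n - k)"
proof (rule antisym)
  show "a n + a (n - k) \<le> a (n + 1)" using a_superadditive n_gt c_pos k_ge by simp
  have "(\<Sum>l\<in>L. a l) \<noteq> a n + a (n - k)" if "L \<subseteq> {1..n}" "legal S L" for L
  proof (cases "n \<in> L")
    case True
    then show ?thesis
      using that n_gt c_pos k_ge by (intro legal_sum_neq_lid_add zero_notin k_in) auto
  next
    case False
    then show ?thesis using legal_sum_lt_of_slack[OF n_gt slack_pos that] by simp
  qed
  then have "\<not> representable S n (a n + a (n - k))"
    by (metis representableE)
  then show "a (n + 1) \<le> a n + a (n - k)"
    using lid_pos[of S n] lid_pos[of S "n - k"] by (intro lid_le) auto
qed

lemma B_step_small: "n < k - c \<Longrightarrow> B (n + 1) - B n \<le> 1"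
  using B_small[of n] B_small[of "n + 1"] k_ge c_pos by (cases "0 \<le> n") auto

lemma B_step_le:
  assumes "n \<le> k + c"
  shows "B (n + 1) - B n \<le> 2 * c + 2"
proof (cases "n < k - c")
  case True
  then show ?thesis using B_step_small[of n] c_pos by simp
next
  case False
  have "B n = a n + B (n - (k - c))" "B (n + 1) = a (n + 1) + B (n - (k - c) + 1)"
    using B_pos[of n] B_pos[of "n + 1"] False k_ge c_pos by (auto simp: algebra_simps)
  moreover have "B (n - (k - c) + 1) - B (n - (k - c)) \<le> 1"
    using assms k_ge c_pos by (intro B_step_small) auto
  moreover have "B (n - (k - c)) = n - (k - c)"
    using assms k_ge c_pos False by (intro B_small) auto
  moreover have "a (n + 1) \<le> B n + 1"
    using k_ge c_pos by (intro lid_Suc_le_stride_sum) auto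
  ultimately show ?thesis using assms by linarith
qed

lemma B_step_recurrence:
  assumes "k + c < n" and "a (n + 1) = a n + a (n - k)"
  shows "B (n + 1) - B n = a (n - k) + (B (n - k + c + 1) - B (n - k + c))"
  using assms B_pos[of n] B_pos[of "n + 1"] k_ge c_pos by (simp add: algebra_simps)

lemma B_step_bound:
  assumes "\<And>n'. k + c < n' \<Longrightarrow> n' \<le> n \<Longrightarrow> a (n' + 1) = a n' + a (n' - k)"
  shows "B (n + 1) - B n \<le> B (n - k) + 2 * c + 2"
  using assms
proof (induction "nat n" arbitrary: n rule: less_induct)
  case less
  show ?case
  proof (cases "n \<le> k + c")
    case True
    then show ?thesis using B_step_le[of n] B_nonneg[of "n - k"] by linarith
  next
    case False
    have "B (n - k + c + 1) - B (n - k + c) \<le> B (n - k + c - k) + 2 * c + 2"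
      using False k_ge c_pos less.prems by (intro less.hyps) auto
    moreover have "B (n - k) = a (n - k) + B (n - k + c - k)"
      using B_pos[of "n - k"] False c_pos by (simp add: algebra_simps)
    ultimately show ?thesis using B_step_recurrence[of n] less.prems[of n] False by simp
  qed
qed

lemma slack_small:
  assumes "c < q" "q \<le> k - 2 * c + 1"
  shows "slack q = q - c"
  using assms lid_small[of "q - 1"] lid_small[of q] B_small[of "q - 1 + c"] c_pos k_ge
  unfolding slack_def by simp

lemma slack_step:
  assumes p_gt: "k + c < p" and slack_pos: "\<And>q. c < q \<Longrightarrow> q \<le> p \<Longrightarrow> 1 \<le> slack q"
    and large: "3 * c + 2 \<le> p - k \<Longrightarrow> 2 * c + 2 \<le> slack (p - k)"
  shows "slack p \<le> slack (p + 1)"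
proof -
  define q where "q = p - k"
  have recurrence: "a (n + 1) = a n + a (n - k)" if "k + c < n" "n \<le> p + k" for n
    using that by (intro recurrence_of_slack slack_pos) auto
  have "B (p + c) - B (p - 1 + c) = a (q - 1 + c) + (B (q + 2 * c) - B (q - 1 + 2 * c))"
    using B_step_recurrence[of "p - 1 + c"] recurrence[of "p - 1 + c"] p_gt k_ge c_pos
    by (simp add: q_def algebra_simps)
  moreover have "a (p - 1) + a (q - 1) \<le> a p" "a p + a q \<le> a (p + 1)"
    using a_superadditive[of "p - 1"] a_superadditive[of p] p_gt k_ge c_pos
    by (auto simp: q_def algebra_simps)
  moreover have "a (q - 1 + c) + (B (q + 2 * c) - B (q - 1 + 2 * c)) \<le> a (q - 1) + a q"
  proof (cases "q - 1 + 2 * c < k - c")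
    case True
    then have "a (q - 1) = q - 1" "a q = q" "a (q - 1 + c) = q - 1 + c"
      using p_gt c_pos by (auto simp: q_def intro!: lid_small)
    then show ?thesis using B_step_small[OF True] p_gt by (simp add: q_def algebra_simps)
  next
    case False
    then have "2 * c + 2 \<le> slack q" using large k_ge by (simp add: q_def)
    moreover have "B (q - 1 + 2 * c + 1) - B (q - 1 + 2 * c) \<le> B (q - 1 + 2 * c - k) + 2 * c + 2"
      using k_ge c_pos by (intro B_step_bound recurrence) (auto simp: q_def)
    moreover have "B (q - 1 + c) = a (q - 1 + c) + B (q - 1 + 2 * c - k)"
      using B_pos[of "q - 1 + c"] p_gt c_pos by (simp add: q_def algebra_simps)
    ultimately show ?thesis unfolding slack_def by (simp add: algebra_simps)
  qed
  ultimately show ?thesis unfolding slack_def by (simp add: algebra_simps)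
qed

lemma slack_boundary: "slack (k - 2 * c + 2) = k - 3 * c + 1"
proof -
  have "B (k - c + 1) = k - c + 2"
    using B_pos[of "k - c + 1"] lid_small[of "k - c + 1"] B_small[of 1] k_ge c_pos by simp
  moreover have "a (k - 2 * c + 1) = k - 2 * c + 1" "a (k - 2 * c + 2) = k - 2 * c + 2"
    using k_ge c_pos by (auto intro!: lid_small)
  ultimately show ?thesis unfolding slack_def by (simp add: algebra_simps)
qed

lemma slack_ge:
  assumes "\<And>q. k - 2 * c + 3 \<le> q \<Longrightarrow> q \<le> k + c + 1 \<Longrightarrow> 2 * c + 2 \<le> slack q"
    and "c < q"
  shows "1 \<le> slack q \<and> (3 * c + 2 \<le> q \<longrightarrow> 2 * c + 2 \<le> slack q)"
  using assms(2)
proof (induction "nat q" arbitrary: q rule: less_induct)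
  case less
  have IH: "1 \<le> slack q' \<and> (3 * c + 2 \<le> q' \<longrightarrow> 2 * c + 2 \<le> slack q')" if "c < q'" "q' < q" for q'
    using less.hyps[of q'] that c_pos by simp
  consider (small) "q \<le> k - 2 * c + 1" | (boundary) "q = k - 2 * c + 2"
    | (middle) "k - 2 * c + 3 \<le> q" "q \<le> k + c + 1" | (large) "k + c + 1 < q"
    by linarith
  then show ?case
  proof cases
    case small
    then show ?thesis using slack_small[of q] less.prems by simp
  next
    case boundary
    then show ?thesis using slack_boundary k_ge c_pos by simp
  next
    case middle
    then show ?thesis using assms(1)[of q] c_pos by simp
  next
    case large
    have "slack (q - 1) \<le> slack (q - 1 + 1)"
      using large IH k_ge c_pos by (intro slack_step) auto
    moreover have "2 * c + 2 \<le> slack (q - 1)"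
      using IH[of "q - 1"] large k_ge c_pos by simp
    ultimately show ?thesis using c_pos by simp
  qed
qed

lemma recurrence_of_middle_slack:
  assumes "\<And>q. k - 2 * c + 3 \<le> q \<Longrightarrow> q \<le> k + c + 1 \<Longrightarrow> 2 * c + 2 \<le> slack q" and "k + c < n"
  shows "a (n + 1) = a n + a (n - k)"
  using slack_ge[OF assms(1), of "n - k"] assms(2) by (intro recurrence_of_slack) simp_all

end

lemma lid_recurrence_lid_set:
  assumes "T \<subseteq> {1..c}" "1 \<le> c" "6 * c + 1 \<le> k"
  shows "lid_recurrence (lid_set T k) k c"
proof (intro lid_recurrence.intro lid_recurrence_axioms.intro)
  show "gapped (lid_set T k) (k - c)" using assms(1,2) by (intro gapped_lid_set) auto
qed (use assms in \<open>auto simp: lid_set_def\<close>)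

lemma slack_eq_f_T:
  assumes "T \<subseteq> {1..c}" "1 \<le> c" "c = Max T" "6 * c + 1 \<le> k" and i_bounds: "- 2 * c + 2 \<le> i" "i \<le> c"
  shows "lid_recurrence.slack (lid_set T k) k c (k + i + 1) =
    k - 2 * c + 1 - (f_T T (i + c) - f_T T i - f_T T (i + 1) + i + 1)"
proof -
  interpret lid_recurrence "lid_set T k" k c
    using assms(1,2,4) by (rule lid_recurrence_lid_set)
  have a_eq_f_T: "a (k + j) = k + f_T T j" if "- 2 * c + 2 \<le> j" "j \<le> 2 * c" for j
    using that assms f_T_eq_lid_offset[of T j k] by (simp add: lid_offset_def)
  have "B (k + i + c) = a (k + (i + c)) + (i + 2 * c)"
    using B_pos[of "k + i + c"] B_small[of "i + 2 * c"] i_bounds assms(2,4) by (simp add: algebra_simps)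
  then show ?thesis
    unfolding slack_def using a_eq_f_T[of "i + c"] a_eq_f_T[of i] a_eq_f_T[of "i + 1"] i_bounds assms(2)
    by (simp add: algebra_simps)
qed

abbreviation (input) threshold_quadratic :: "int \<Rightarrow> int \<Rightarrow> real" where
  "threshold_quadratic c i \<equiv> 1/2 * (real_of_int i)\<^sup>2 + (3/2 - real_of_int c) * real_of_int i
     + (1 + 1/2 * real_of_int c - 3/2 * (real_of_int c)\<^sup>2)"

lemma threshold_quadratic_pos:
  assumes "0 \<le> c" "4 * c \<le> i"
  shows "0 < threshold_quadratic c i"
proof -
  define x z where "x = real_of_int c" and "z = real_of_int (i - 4 * c)"
  have "threshold_quadratic c i = 5/2 * x\<^sup>2 + 3 * (x * z) + 1/2 * z\<^sup>2 + 13/2 * x + 3/2 * z + 1"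
    by (simp add: x_def z_def field_simps power2_eq_square)
  also have "\<dots> > 0"
    using assms by (intro add_nonneg_pos add_nonneg_nonneg) (simp_all add: x_def z_def)
  finally show ?thesis .
qed

lemma threshold_quadratic_0_nonpos:
  assumes "1 \<le> c"
  shows "threshold_quadratic c 0 \<le> 0"
proof -
  have "threshold_quadratic c 0 = (1 - real_of_int c) * (1 + 3/2 * real_of_int c)"
    by (simp add: field_simps power2_eq_square)
  also have "\<dots> \<le> 0" using assms by (intro mult_nonpos_nonneg) simp_all
  finally show ?thesis .
qed

lemma one_le_Least_threshold:
  assumes "1 \<le> c"
  shows "1 \<le> (LEAST m. m \<ge> 0 \<and> (\<forall>i\<ge>m. threshold_quadratic c i > 0))" (is "1 \<le> (LEAST m. ?P m)")
proof -
  have "?P (4 * c)" using assms threshold_quadratic_pos by simp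
  then have least: "?P (LEAST m. ?P m)" by (rule bounded_int_LeastI[where b = 0]) blast
  have "1 \<le> m" if "?P m" for m
  proof -
    have "m \<noteq> 0" using that threshold_quadratic_0_nonpos[OF assms] by (auto simp: not_less)
    then show ?thesis using that by simp
  qed
  from this[OF least] show ?thesis .
qed

theorem theorem3p10:
  fixes T :: "int set" and c m d k :: int
  assumes "finite T" and "T \<noteq> {}" and "\<forall>t\<in>T. t > 0"
    and "c = Max T"
    and "m = (LEAST m. m \<ge> 0 \<and> (\<forall>i\<ge>m.
           1/2 * (real_of_int i)\<^sup>2 + (3/2 - real_of_int c) * real_of_int i
             + (1 + 1/2 * real_of_int c - 3/2 * (real_of_int c)\<^sup>2) > 0))"
    and "d = max (2 * c + m - 1)
           (MAX i\<in>{- 2 * c + 2..c + m}. f_T T (i + c) - f_T T i - f_T T (i + 1) + i + 1)"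
    and "k \<ge> max (2 * d - 4 * c + 2) (4 * c + d + 1)"
    and "k > (MAX i\<in>{- 2 * c + 2..c + d + 2}.
           f_T T (i - 1 + c) - f_T T (i - 1) - f_T T i + i + 2 * c - 1)"
  shows "\<forall>n > k + c. lid (lid_set T k) (n + 1) = lid (lid_set T k) n + lid (lid_set T k) (n - k)"
proof -
  have "c \<in> T" using assms(1,2,4) by simp
  then have c_ge_1: "1 \<le> c" using assms(3) by force
  have T_subset: "T \<subseteq> {1..c}" using assms(1,3,4) by force
  have "1 \<le> m" unfolding assms(5) using c_ge_1 by (rule one_le_Least_threshold)
  moreover have "2 * c + m - 1 \<le> d" and k_ge_d: "4 * c + d + 1 \<le> k"
    using assms(6,7) by simp_all
  ultimately have k_ge: "6 * c + 1 \<le> k" by simp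
  interpret lid_recurrence "lid_set T k" k c
    using T_subset c_ge_1 k_ge by (rule lid_recurrence_lid_set)
  have "2 * c + 2 \<le> slack q" if q_bounds: "k - 2 * c + 3 \<le> q" "q \<le> k + c + 1" for q
  proof -
    define i where "i = q - k - 1"
    have i_bounds: "- 2 * c + 2 \<le> i" "i \<le> c" and q_eq: "q = k + i + 1"
      using q_bounds by (simp_all add: i_def)
    have "f_T T (i + c) - f_T T i - f_T T (i + 1) + i + 1 \<le> d"
      unfolding assms(6) using i_bounds \<open>1 \<le> m\<close> by (auto intro!: max.coboundedI2 Max_ge)
    then show ?thesis
      using slack_eq_f_T[OF T_subset c_ge_1 assms(4) k_ge i_bounds] k_ge_d by (simp add: q_eq)
  qed
  then show ?thesis using recurrence_of_middle_slack by blast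
qed

end
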